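(* Let $A\in\mathbb{R}^{m\times n}$ with $m<n$, let $k\ge 1$ be an integer, let $\sigma_1$ and $\sigma_m$ be the largest and smallest singular values of $A$, and suppose that the restricted isometry constant of order $3k$ of $A$ satisfies $\delta_{3k}<\frac{1}{\sqrt{3}}$. Let $\epsilon$ be a real number satisfying $$\epsilon>\max\left\{\sigma_1^2,\ \left(\frac{\sigma_1^2-\sigma_m^2}{\frac{1}{\sqrt3}-\delta_{3k}}-1\right)\sigma_1^2\right\},$$ and let $\lambda$ be a real number satisfying $$\epsilon+\sigma_1^2-\left(\frac{1}{\sqrt3}-\delta_{3k}\right)\frac{\epsilon+\sigma_1^2}{\sigma_1^2}<\lambda\le\epsilon+\sigma_m^2.$$ Then for every $k$-sparse vector $x\in\mathbb{R}^n$ with accurate measurements $y:=Ax$, every sequence $\{x^p\}_{p\ge 0}$ generated by the NSIHT algorithm with input $(A,y,k,\epsilon,\lambda)$ converges to $x$.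
   Context: A vector is $q$-sparse if it has at most $q$ nonzero entries. The singular values of $A\in\mathbb{R}^{m\times n}$ ($m<n$) are $\sigma_1\ge\sigma_2\ge\dots\ge\sigma_m\ge 0$ (the square roots of the eigenvalues of $AA^T$), so $\sigma_m$ may be $0$. Restricted isometry constant: for an integer $q\ge1$, $\delta_q=\max_{S\subseteq\{1,\dots,n\},\,|S|\le q}\|A_S^TA_S-I\|_2$, where $A_S$ is the submatrix of columns of $A$ indexed by $S$ and $\|\cdot\|_2$ is the spectral norm; equivalently, $\delta_q$ is the smallest $\delta\ge 0$ with $(1-\delta)\|z\|_2^2\le\|Az\|_2^2\le(1+\delta)\|z\|_2^2$ for all $q$-sparse $z\in\mathbb{R}^n$. Hard thresholding operator: for $z\in\mathbb{R}^n$, $\mathcal{H}_k(z)$ is the vector obtained from $z$ by keeping $k$ entries of largest absolute value and setting all other entries to $0$ (ties are broken arbitrarily). NSIHT algorithm (Newton-step-based iterative hard thresholding): starting from an initial point $x^0\in\mathbb{R}^n$, for $p=0,1,2,\dots$, $$x^{p+1}=\mathcal{H}_k\left(x^p+\lambda(A^TA+\epsilon I)^{-1}A^T(y-Ax^p)\right).$$ *)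

theory Defs
  imports "HOL-Analysis.Analysis"
begin

definition sparse_vec :: "nat \<Rightarrow> real ^ 'n \<Rightarrow> bool" where
  "sparse_vec q z \<longleftrightarrow> card {i. z $ i \<noteq> 0} \<le> q"

definition mat_eigenvalue :: "real ^ 'n ^ 'n \<Rightarrow> real \<Rightarrow> bool" where
  "mat_eigenvalue M \<mu> \<longleftrightarrow> (\<exists>v. v \<noteq> 0 \<and> M *v v = \<mu> *\<^sub>R v)"

text \<open>Multiplicities are irrelevant for the largest and the smallest singular value, so the
  singular values are collected in a (finite, nonempty) set. It is the \<open>m \<times> m\<close> matrix
  \<open>A A\<^sup>T\<close> that counts: for \<open>m < n\<close> the matrix \<open>A\<^sup>T A\<close> always has the eigenvalue 0.\<close>

definition singular_values :: "real ^ 'n ^ 'm \<Rightarrow> real set" where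
  "singular_values A = {sqrt \<mu> |\<mu>. mat_eigenvalue (A ** transpose A) \<mu>}"

definition sigma_max :: "real ^ 'n ^ 'm \<Rightarrow> real" where
  "sigma_max A = Max (singular_values A)"

definition sigma_min :: "real ^ 'n ^ 'm \<Rightarrow> real" where
  "sigma_min A = Min (singular_values A)"

definition spectral_norm :: "real ^ 'n ^ 'm \<Rightarrow> real" where
  "spectral_norm M = onorm (\<lambda>z. M *v z)"

text \<open>Submatrices are padded with zeros to the full index type: the columns outside \<open>S\<close> are
  replaced by 0, and the identity matrix of size \<open>S \<times> S\<close> becomes a 0/1 diagonal matrix.
  Then \<open>A\<^sub>S\<^sup>T A\<^sub>S - I\<close> is padded with zero rows and columns, which does not change its
  spectral norm (and gives norm 0 for \<open>S = {}\<close>).\<close>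

definition column_submatrix :: "real ^ 'n ^ 'm \<Rightarrow> 'n set \<Rightarrow> real ^ 'n ^ 'm" where
  "column_submatrix A S = (\<chi> i j. if j \<in> S then A $ i $ j else 0)"

definition identity_on :: "'n set \<Rightarrow> real ^ 'n ^ 'n" where
  "identity_on S = (\<chi> i j. if i = j \<and> i \<in> S then 1 else 0)"

definition RIC :: "nat \<Rightarrow> real ^ 'n ^ 'm \<Rightarrow> real" where
  "RIC q A = (MAX S \<in> {S. card S \<le> q}.
     spectral_norm (transpose (column_submatrix A S) ** column_submatrix A S - identity_on S))"

text \<open>Because ties are broken arbitrarily, hard thresholding is a relation: \<open>w\<close> is an
  admissible value of \<open>\<H>\<^sub>k(z)\<close>, \<open>S\<close> being the set of retained positions.
  If \<open>k\<close> exceeds the dimension, all entries are retained.\<close>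

definition hard_thresholding :: "nat \<Rightarrow> real ^ 'n \<Rightarrow> real ^ 'n \<Rightarrow> bool" where
  "hard_thresholding k z w \<longleftrightarrow>
     (\<exists>S. card S = min k CARD('n) \<and>
          (\<forall>i\<in>S. \<forall>j. j \<notin> S \<longrightarrow> \<bar>z $ j\<bar> \<le> \<bar>z $ i\<bar>) \<and>
          w = (\<chi> i. if i \<in> S then z $ i else 0))"

definition NSIHT_sequence ::
  "real ^ 'n ^ 'm \<Rightarrow> real ^ 'm \<Rightarrow> nat \<Rightarrow> real \<Rightarrow> real \<Rightarrow> (nat \<Rightarrow> real ^ 'n) \<Rightarrow> bool" where
  "NSIHT_sequence A y k \<epsilon> l X \<longleftrightarrow>
     (\<forall>p. hard_thresholding k
            (X p + l *\<^sub>R (matrix_inv (transpose A ** A + \<epsilon> *\<^sub>R mat 1) *v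
                          (transpose A *v (y - A *v X p))))
            (X (Suc p)))"

end

(* Put d = x - x^p, let S and S' be the supports of x and x^{p+1}, and let u be the point that is
   thresholded. Hard thresholding satisfies |x^{p+1} - x| <= sqrt 3 |(u - x)_{S Un S'}|, and
   x - u = (I - A^T A) d + (A^T A - l (A^T A + eps I)^{-1} A^T A) d. For p >= 1 the vector d is
   2k-sparse, so on S, S' and the support of d together (at most 3k indices) the first term is at
   most delta_{3k} |d|. The second operator is A^T (I - l (A A^T + eps I)^{-1}) A, of norm at most
   sigma_1^2 (1 - l / (eps + sigma_1^2)) because 0 < l <= eps + sigma_m^2. The lower bound on l
   makes the sum of the two constants less than 1 / sqrt 3, and l > 0 follows from
   delta_{3k} >= 1 - sigma_1^2. *)
theory Submission
  imports Defs
begin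

section \<open>Symmetric and positive semidefinite operators\<close>

text \<open>Nonnegativity of the quadratic form of \<open>f\<close> along the line
  \<open>u + t *\<^sub>R v\<close>. The form may be degenerate, so a vanishing leading coefficient
  is treated separately.\<close>

lemma psd_Cauchy_Schwarz:
  fixes f :: "'a::real_inner \<Rightarrow> 'a"
  assumes lin: "linear f" and sym: "\<And>u v. f u \<bullet> v = u \<bullet> f v" and psd: "\<And>u. f u \<bullet> u \<ge> 0"
  shows "(f u \<bullet> v)\<^sup>2 \<le> (f u \<bullet> u) * (f v \<bullet> v)"
proof -
  let ?a = "f u \<bullet> u" and ?b = "f u \<bullet> v" and ?c = "f v \<bullet> v"
  have vu: "f v \<bullet> u = ?b"
    using sym[of v u] by (simp add: inner_commute)
  have q: "?a + 2 * t * ?b + t\<^sup>2 * ?c \<ge> 0" for t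
  proof -
    have "f (u + t *\<^sub>R v) \<bullet> (u + t *\<^sub>R v) = ?a + 2 * t * ?b + t\<^sup>2 * ?c"
      by (simp add: linear_add[OF lin] linear_scale[OF lin] inner_add_left inner_add_right vu
          algebra_simps power2_eq_square)
    then show ?thesis
      using psd[of "u + t *\<^sub>R v"] by simp
  qed
  show ?thesis
  proof (cases "?c = 0")
    case True
    have "?b = 0"
    proof (rule ccontr)
      assume "?b \<noteq> 0"
      \<comment> \<open>This \<open>t\<close> makes the now affine polynomial equal to -1.\<close>
      then show False
        using q[of "- (?a + 1) / (2 * ?b)"] True by (simp add: field_simps)
    qed
    then show ?thesis
      using True by simp
  next
    case False
    then have c: "?c > 0"
      using psd[of v] by simp
    \<comment> \<open>The minimiser of the quadratic is \<open>t = - ?b / ?c\<close>.\<close>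
    have "?a + 2 * (- ?b / ?c) * ?b + (- ?b / ?c)\<^sup>2 * ?c = ?a - ?b\<^sup>2 / ?c"
      using c by (simp add: field_simps power2_eq_square)
    then have "?b\<^sup>2 / ?c \<le> ?a"
      using q[of "- ?b / ?c"] by simp
    then show ?thesis
      using c by (simp add: field_simps)
  qed
qed

text \<open>Operator form: \<open>0 \<le> f \<le> b\<close> implies that the square of
  \<open>f\<close> is at most \<open>b\<close> times \<open>f\<close>. Cauchy-Schwarz is applied to
  \<open>u\<close> and \<open>f u\<close>, and one factor \<open>f u \<bullet> f u\<close> is
  cancelled.\<close>

lemma psd_norm_square_le:
  fixes f :: "'a::real_inner \<Rightarrow> 'a"
  assumes lin: "linear f" and sym: "\<And>u v. f u \<bullet> v = u \<bullet> f v" and psd: "\<And>u. f u \<bullet> u \<ge> 0"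
    and bound: "\<And>u. f u \<bullet> u \<le> b * (u \<bullet> u)"
  shows "f u \<bullet> f u \<le> b * (f u \<bullet> u)"
proof (cases "f u = 0")
  case False
  have "(f u \<bullet> f u)\<^sup>2 \<le> (f u \<bullet> u) * (f (f u) \<bullet> f u)"
    by (rule psd_Cauchy_Schwarz[OF lin sym psd])
  also have "\<dots> \<le> (f u \<bullet> u) * (b * (f u \<bullet> f u))"
    by (intro mult_left_mono bound psd)
  finally have "(f u \<bullet> f u) * (f u \<bullet> f u) \<le> (f u \<bullet> f u) * (b * (f u \<bullet> u))"
    by (simp add: power2_eq_square algebra_simps)
  then show ?thesis
    using False by (simp add: mult_le_cancel_left)
qed simp

text \<open>The Rayleigh quotient attains its maximum \<open>\<mu>\<close> on the compact unit
  sphere. Then \<open>\<mu> - f\<close> is positive semidefinite with vanishing form at the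
  maximiser \<open>v\<close>, so by Cauchy-Schwarz it sends \<open>v\<close> to 0.\<close>

lemma exists_top_eigenvector:
  fixes f :: "'a::euclidean_space \<Rightarrow> 'a"
  assumes lin: "linear f" and sym: "\<And>u v. f u \<bullet> v = u \<bullet> f v"
  obtains \<mu> v where "v \<noteq> 0" "f v = \<mu> *\<^sub>R v" "\<And>u. f u \<bullet> u \<le> \<mu> * (u \<bullet> u)"
proof -
  have cont: "continuous_on (sphere 0 1) (\<lambda>u. f u \<bullet> u)"
    by (intro continuous_intros linear_continuous_on_compose[OF continuous_on_id lin])
  have ne: "sphere (0::'a) 1 \<noteq> {}"
    by simp
  obtain v where v: "v \<in> sphere 0 1" and max: "\<And>u. u \<in> sphere 0 1 \<Longrightarrow> f u \<bullet> u \<le> f v \<bullet> v"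
    using continuous_attains_sup[OF compact_sphere ne cont] by blast
  define \<mu> where "\<mu> = f v \<bullet> v"
  define g where "g = (\<lambda>u. \<mu> *\<^sub>R u - f u)"
  have le: "f u \<bullet> u \<le> \<mu> * (u \<bullet> u)" for u
  proof (cases "u = 0")
    case False
    have "f (u /\<^sub>R norm u) \<bullet> (u /\<^sub>R norm u) \<le> \<mu>"
      unfolding \<mu>_def using False by (intro max) simp
    then have "(f u \<bullet> u) / (norm u)\<^sup>2 \<le> \<mu>"
      by (simp add: linear_scale[OF lin] power2_eq_square divide_inverse mult_ac)
    then show ?thesis
      using False by (simp add: field_simps flip: power2_norm_eq_inner)
  qed (simp add: linear_0[OF lin])
  have vv: "v \<bullet> v = 1"
    using v by (simp add: norm_eq_1)
  have ling: "linear g"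
    unfolding g_def by (intro linear_compose_sub linear_compose_scale_right lin linear_id[unfolded id_def])
  have symg: "g u \<bullet> w = u \<bullet> g w" for u w
    by (simp add: g_def inner_diff_left inner_diff_right sym)
  have psdg: "g u \<bullet> u \<ge> 0" for u
    using le[of u] by (simp add: g_def inner_diff_left)
  have "g v \<bullet> v = 0"
    by (simp add: g_def inner_diff_left vv \<mu>_def)
  then have "(g v \<bullet> g v)\<^sup>2 \<le> 0"
    using psd_Cauchy_Schwarz[OF ling symg psdg, of v "g v"] by simp
  then have "g v = 0"
    by simp
  then have "f v = \<mu> *\<^sub>R v"
    by (simp add: g_def)
  moreover have "v \<noteq> 0"
    using vv by auto
  ultimately show ?thesis
    using that le by blast
qed

text \<open>Eigenvectors of distinct eigenvalues are orthogonal, and a pairwise orthogonal set is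
  finite in finite dimension. Finiteness gives \<open>Max\<close> and \<open>Min\<close> of the
  singular values their meaning.\<close>

lemma finite_eigenvalues_symmetric:
  fixes f :: "'a::euclidean_space \<Rightarrow> 'a"
  assumes sym: "\<And>u v. f u \<bullet> v = u \<bullet> f v"
  shows "finite {\<mu>. \<exists>v. v \<noteq> 0 \<and> f v = \<mu> *\<^sub>R v}"
proof -
  define E where "E = {\<mu>. \<exists>v. v \<noteq> 0 \<and> f v = \<mu> *\<^sub>R v}"
  have "\<forall>\<mu>\<in>E. \<exists>v. v \<noteq> 0 \<and> f v = \<mu> *\<^sub>R v"
    by (simp add: E_def)
  then obtain e where e: "\<And>\<mu>. \<mu> \<in> E \<Longrightarrow> e \<mu> \<noteq> 0 \<and> f (e \<mu>) = \<mu> *\<^sub>R e \<mu>"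
    by metis
  have orth: "e \<mu> \<bullet> e \<nu> = 0" if "\<mu> \<in> E" "\<nu> \<in> E" "\<mu> \<noteq> \<nu>" for \<mu> \<nu>
    using sym[of "e \<mu>" "e \<nu>"] e that by simp
  have "pairwise orthogonal (e ` E)"
    using orth by (force simp: pairwise_def orthogonal_def)
  then have "finite (e ` E)"
    by (rule pairwise_orthogonal_imp_finite)
  moreover have "inj_on e E"
    by (rule inj_onI) (metis orth e inner_eq_zero_iff)
  ultimately have "finite E"
    using finite_image_iff by blast
  then show ?thesis
    by (simp add: E_def)
qed

section \<open>The Gram matrix and the extreme singular values\<close>

lemma matrix_vector_inner_transpose:
  fixes M :: "real ^ 'n ^ 'm"
  shows "(M *v u) \<bullet> v = u \<bullet> (transpose M *v v)"
  by (metis dot_lmul_matrix inner_commute transpose_matrix_vector)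

lemma gram_inner:
  fixes A :: "real ^ 'n ^ 'm"
  shows "((A ** transpose A) *v u) \<bullet> v = (transpose A *v u) \<bullet> (transpose A *v v)"
  by (simp add: matrix_vector_inner_transpose flip: matrix_vector_mul_assoc)

lemma gram_symmetric:
  fixes A :: "real ^ 'n ^ 'm"
  shows "((A ** transpose A) *v u) \<bullet> v = u \<bullet> ((A ** transpose A) *v v)"
  by (metis gram_inner inner_commute)

lemma finite_singular_values: "finite (singular_values A)"
proof -
  have "singular_values A = sqrt ` {\<mu>. \<exists>v. v \<noteq> 0 \<and> (A ** transpose A) *v v = \<mu> *\<^sub>R v}"
    unfolding singular_values_def mat_eigenvalue_def by blast
  then show ?thesis
    using finite_eigenvalues_symmetric[of "(*v) (A ** transpose A)", OF gram_symmetric] by simp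
qed

text \<open>Ensures that \<open>sqrt\<close> in \<open>singular_values\<close> is a genuine square
  root; on negative reals it takes negative values.\<close>

lemma gram_eigenvalue_nonneg:
  assumes "mat_eigenvalue (A ** transpose A) \<mu>"
  shows "\<mu> \<ge> 0"
proof -
  obtain v where v: "v \<noteq> 0" "(A ** transpose A) *v v = \<mu> *\<^sub>R v"
    using assms by (auto simp: mat_eigenvalue_def)
  have "0 \<le> (transpose A *v v) \<bullet> (transpose A *v v)"
    by simp
  also have "\<dots> = \<mu> * (v \<bullet> v)"
    using v(2) gram_inner[of A v v] by simp
  finally show ?thesis
    using v(1) by (simp add: zero_le_mult_iff flip: inner_gt_zero_iff)
qed

text \<open>The maximal Rayleigh quotient is an eigenvalue, so its root is one of the singular
  values.\<close>

lemma gram_le_sigma_max: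
  "((A ** transpose A) *v u) \<bullet> u \<le> (sigma_max A)\<^sup>2 * (u \<bullet> u)"
proof -
  obtain \<mu> v where v: "v \<noteq> 0" "(A ** transpose A) *v v = \<mu> *\<^sub>R v"
    and le: "\<And>u. ((A ** transpose A) *v u) \<bullet> u \<le> \<mu> * (u \<bullet> u)"
    using exists_top_eigenvector[of "(*v) (A ** transpose A)", OF _ gram_symmetric]
    by (metis matrix_vector_mul_linear)
  have ev: "mat_eigenvalue (A ** transpose A) \<mu>"
    using v by (auto simp: mat_eigenvalue_def)
  then have "sqrt \<mu> \<le> sigma_max A"
    unfolding sigma_max_def by (intro Max_ge finite_singular_values) (auto simp: singular_values_def)
  then have "\<mu> \<le> (sigma_max A)\<^sup>2"
    using sqrt_le_D by blast
  then show ?thesis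
    using le[of u] mult_right_mono[of \<mu> "(sigma_max A)\<^sup>2" "u \<bullet> u"] by simp
qed

lemma singular_values_nonempty: "singular_values A \<noteq> {}"
  using exists_top_eigenvector[of "(*v) (A ** transpose A)", OF _ gram_symmetric]
  by (simp add: singular_values_def mat_eigenvalue_def) (metis matrix_vector_mul_linear)

lemma sigma_min_nonneg: "sigma_min A \<ge> 0"
  using Min_in[OF finite_singular_values singular_values_nonempty, of A]
  by (auto simp: sigma_min_def singular_values_def intro: gram_eigenvalue_nonneg)

lemma sigma_min_le_sigma_max: "sigma_min A \<le> sigma_max A"
  unfolding sigma_min_def sigma_max_def
  by (rule Min_le) (auto simp: finite_singular_values singular_values_nonempty)

text \<open>The top eigenvector of the negated Gram matrix belongs to the bottom of its
  spectrum.\<close>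

lemma sigma_min_le_gram:
  "(sigma_min A)\<^sup>2 * (u \<bullet> u) \<le> ((A ** transpose A) *v u) \<bullet> u"
proof -
  let ?f = "\<lambda>u. - ((A ** transpose A) *v u)"
  have "linear ?f"
    by (intro linear_compose_neg matrix_vector_mul_linear)
  moreover have "?f u \<bullet> v = u \<bullet> ?f v" for u v
    by (simp add: gram_symmetric)
  ultimately obtain \<nu> v where v: "v \<noteq> 0" "?f v = \<nu> *\<^sub>R v"
    and le: "\<And>u. ?f u \<bullet> u \<le> \<nu> * (u \<bullet> u)"
    using exists_top_eigenvector[of ?f] by metis
  have "(A ** transpose A) *v v = (- \<nu>) *\<^sub>R v"
    using v(2) by (metis minus_minus scaleR_minus_left)
  then have ev: "mat_eigenvalue (A ** transpose A) (- \<nu>)"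
    using v(1) by (auto simp: mat_eigenvalue_def)
  then have "sigma_min A \<le> sqrt (- \<nu>)"
    unfolding sigma_min_def by (intro Min_le finite_singular_values) (auto simp: singular_values_def)
  then have "(sigma_min A)\<^sup>2 \<le> - \<nu>"
    using sigma_min_nonneg[of A] gram_eigenvalue_nonneg[OF ev]
    by (metis power_mono real_sqrt_pow2)
  then show ?thesis
    using le[of u] mult_right_mono[of "(sigma_min A)\<^sup>2" "- \<nu>" "u \<bullet> u"] by simp
qed

lemma norm_transpose_matrix_vector_le: "norm (transpose A *v u) \<le> sigma_max A * norm u"
proof (rule power2_le_imp_le)
  show "(norm (transpose A *v u))\<^sup>2 \<le> (sigma_max A * norm u)\<^sup>2"
    using gram_le_sigma_max[of A u]
    by (simp add: power2_norm_eq_inner power_mult_distrib gram_inner)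
  show "0 \<le> sigma_max A * norm u"
    using sigma_min_nonneg[of A] sigma_min_le_sigma_max[of A] by simp
qed

text \<open>Transferred from the transpose by duality: the square of \<open>norm (A *v u)\<close> is
  the inner product of \<open>u\<close> with \<open>transpose A *v (A *v u)\<close>.\<close>

lemma norm_matrix_vector_le: "norm (A *v u) \<le> sigma_max A * norm u"
proof (cases "A *v u = 0")
  case True
  then show ?thesis
    using sigma_min_nonneg[of A] sigma_min_le_sigma_max[of A] by simp
next
  case False
  have "norm (A *v u) * norm (A *v u) = u \<bullet> (transpose A *v (A *v u))"
    by (simp add: matrix_vector_inner_transpose power2_norm_eq_inner flip: power2_eq_square)
  also have "\<dots> \<le> norm u * norm (transpose A *v (A *v u))"
    by (rule norm_cauchy_schwarz)
  also have "\<dots> \<le> norm u * (sigma_max A * norm (A *v u))"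
    by (intro mult_left_mono norm_transpose_matrix_vector_le) simp
  finally show ?thesis
    using False by (simp add: mult_ac mult_le_cancel_left)
qed


section \<open>The Newton step compared with the gradient step\<close>

text \<open>Says that the identity minus \<open>l\<close> times the inverse of \<open>f\<close> has
  norm at most \<open>1 - l / b\<close>, written with \<open>w\<close> as the preimage to avoid the
  inverse. Spectrally, \<open>0 \<le> 1 - l / t \<le> 1 - l / b\<close> for \<open>t\<close> between
  \<open>a\<close> and \<open>b\<close>, since \<open>l \<le> a\<close>.\<close>

lemma norm_resolvent_contraction:
  fixes f :: "'a::real_inner \<Rightarrow> 'a"
  assumes lin: "linear f" and sym: "\<And>u v. f u \<bullet> v = u \<bullet> f v"
    and low: "\<And>u. a * (u \<bullet> u) \<le> f u \<bullet> u" and up: "\<And>u. f u \<bullet> u \<le> b * (u \<bullet> u)"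
    and l: "0 < l" "l \<le> a" "a \<le> b"
  shows "norm (f w - l *\<^sub>R w) \<le> (1 - l / b) * norm (f w)"
proof (rule power2_le_imp_le)
  have b: "b > 0"
    using l by simp
  \<comment> \<open>\<open>0 \<le> P \<le> b - a\<close> gives \<open>P\<^sup>2 \<le> (b - a) P\<close>, i.e. \<open>(b - f) (f - a) \<ge> 0\<close>, without diagonalising \<open>f\<close>.\<close>
  define P where "P = (\<lambda>u. f u - a *\<^sub>R u)"
  have linP: "linear P"
    unfolding P_def by (intro linear_compose_sub linear_compose_scale_right lin linear_id[unfolded id_def])
  have symP: "P u \<bullet> v = u \<bullet> P v" for u v
    by (simp add: P_def inner_diff_left inner_diff_right sym)
  have "P w \<bullet> P w \<le> (b - a) * (P w \<bullet> w)"
    using low up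
    by (intro psd_norm_square_le[OF linP symP])
      (auto simp: P_def inner_diff_left left_diff_distrib)
  then have F: "f w \<bullet> f w \<le> (a + b) * (f w \<bullet> w) - a * b * (w \<bullet> w)"
    by (simp add: P_def inner_diff_left inner_diff_right inner_commute algebra_simps)
  define q s where "q = f w \<bullet> w" and "s = w \<bullet> w"
  have qs: "q \<le> b * s"
    using up by (simp add: q_def s_def)
  have c: "0 \<le> 2 * b - l"
    using l by simp
  \<comment> \<open>Makes the coefficient of \<open>q\<close> below nonnegative, so that
    \<open>q\<close> can be replaced by its upper bound \<open>b * s\<close>.\<close>
  have "l * (a + b) \<le> a * (a + b)"
    using l by (intro mult_right_mono) auto
  also have "\<dots> \<le> a * (b + b)"
    using l by (intro mult_left_mono) auto
  finally have "l * (a + b) \<le> 2 * a * b"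
    by simp
  then have k: "(2 * a * b - l * (a + b)) * q \<le> (2 * a * b - l * (a + b)) * (b * s)"
    by (intro mult_left_mono qs) simp
  \<comment> \<open>Up to the positive factor \<open>l / b\<^sup>2\<close>, the left side is the
    difference of the two squared norms to be compared.\<close>
  have "b\<^sup>2 * (l * s - 2 * q) + (2 * b - l) * (f w \<bullet> f w)
      \<le> b\<^sup>2 * (l * s - 2 * q) + (2 * b - l) * ((a + b) * q - a * b * s)"
    using F c by (intro add_left_mono mult_left_mono) (auto simp: q_def s_def)
  also have "\<dots> = b\<^sup>2 * l * s - (2 * b - l) * a * b * s + (2 * a * b - l * (a + b)) * q"
    by (simp add: algebra_simps power2_eq_square)
  also have "\<dots> \<le> b\<^sup>2 * l * s - (2 * b - l) * a * b * s + (2 * a * b - l * (a + b)) * (b * s)"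
    using k by simp
  also have "\<dots> = 0"
    by (simp add: algebra_simps power2_eq_square)
  finally have main: "l * (b\<^sup>2 * (l * s - 2 * q) + (2 * b - l) * (f w \<bullet> f w)) \<le> 0"
    using l by (simp add: mult_le_0_iff)
  have "(norm (f w - l *\<^sub>R w))\<^sup>2 - ((1 - l / b) * norm (f w))\<^sup>2
      = l * (b\<^sup>2 * (l * s - 2 * q) + (2 * b - l) * (f w \<bullet> f w)) / b\<^sup>2"
    using b unfolding q_def s_def power_mult_distrib power2_norm_eq_inner
    by (simp add: inner_diff_left inner_diff_right inner_commute[of w "f w"] field_simps power2_eq_square)
  also have "\<dots> \<le> 0"
    using main by (simp add: divide_le_0_iff)
  finally show "(norm (f w - l *\<^sub>R w))\<^sup>2 \<le> ((1 - l / b) * norm (f w))\<^sup>2"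
    by simp
  show "0 \<le> (1 - l / b) * norm (f w)"
    using l b by simp
qed

text \<open>\<open>matrix_inv\<close> is a choice term, so invertibility has to come first; strict
  positivity gives a trivial kernel.\<close>

lemma matrix_inv_mult_vector:
  fixes M :: "real ^ 'n ^ 'n"
  assumes pos: "\<And>u. u \<noteq> 0 \<Longrightarrow> (M *v u) \<bullet> u > 0"
  shows "matrix_inv M *v (M *v u) = u" and "M *v (matrix_inv M *v u) = u"
proof -
  have "\<forall>u. M *v u = 0 \<longrightarrow> u = 0"
    using pos by force
  then have "invertible M"
    by (simp add: invertible_left_inverse matrix_left_invertible_ker)
  then have "matrix_inv M ** M = mat 1" "M ** matrix_inv M = mat 1"
    unfolding matrix_inv_def invertible_def by (metis (mono_tags, lifting) someI_ex)+
  then show "matrix_inv M *v (M *v u) = u" "M *v (matrix_inv M *v u) = u"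
    by (simp_all add: matrix_vector_mul_assoc)
qed

text \<open>With \<open>D *v w = A *v e\<close> the vector becomes
  \<open>transpose A *v (D *v w - l *\<^sub>R w)\<close>. The outer factors
  \<open>transpose A\<close> and \<open>A\<close> contribute \<open>sigma_max A\<close> each, the
  middle one contracts.\<close>

lemma norm_gradient_minus_newton_step_le:
  fixes A :: "real ^ 'n ^ 'm"
  assumes e: "\<epsilon> > 0" and l: "0 < l" "l \<le> \<epsilon> + (sigma_min A)\<^sup>2"
  shows "norm (transpose A *v (A *v e)
      - l *\<^sub>R (matrix_inv (transpose A ** A + \<epsilon> *\<^sub>R mat 1) *v (transpose A *v (A *v e))))
    \<le> (sigma_max A)\<^sup>2 * (1 - l / (\<epsilon> + (sigma_max A)\<^sup>2)) * norm e"
proof -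
  define C where "C = A ** transpose A"
  define D where "D = C + \<epsilon> *\<^sub>R mat 1"
  define B where "B = transpose A ** A + \<epsilon> *\<^sub>R mat 1"
  define w where "w = matrix_inv D *v (A *v e)"
  have D: "D *v u = C *v u + \<epsilon> *\<^sub>R u" for u
    by (simp add: D_def matrix_vector_mult_add_rdistrib flip: scaleR_matrix_vector_assoc)
  have B: "B *v u = transpose A *v (A *v u) + \<epsilon> *\<^sub>R u" for u
    by (simp add: B_def matrix_vector_mult_add_rdistrib matrix_vector_mul_assoc
        flip: scaleR_matrix_vector_assoc transpose_matrix_vector)
  have low: "(\<epsilon> + (sigma_min A)\<^sup>2) * (u \<bullet> u) \<le> (D *v u) \<bullet> u" for u
    using sigma_min_le_gram[of A u] by (simp add: D C_def inner_add_left algebra_simps)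
  have up: "(D *v u) \<bullet> u \<le> (\<epsilon> + (sigma_max A)\<^sup>2) * (u \<bullet> u)" for u
    using gram_le_sigma_max[of A u] by (simp add: D C_def inner_add_left algebra_simps)
  have symD: "(D *v u) \<bullet> v = u \<bullet> (D *v v)" for u v
    by (simp add: D C_def inner_add_left inner_add_right gram_symmetric)
  have Dw: "D *v w = A *v e"
    unfolding w_def
  proof (rule matrix_inv_mult_vector(2))
    fix u :: "real ^ 'm" assume "u \<noteq> 0"
    then have "0 < (\<epsilon> + (sigma_min A)\<^sup>2) * (u \<bullet> u)"
      using e by (intro mult_pos_pos) (auto intro: add_pos_nonneg)
    then show "(D *v u) \<bullet> u > 0"
      using low[of u] by simp
  qed
  have Bpos: "(B *v u) \<bullet> u > 0" if "u \<noteq> 0" for u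
  proof -
    have "(B *v u) \<bullet> u = (A *v u) \<bullet> (A *v u) + \<epsilon> * (u \<bullet> u)"
      unfolding B inner_add_left matrix_vector_inner_transpose by simp
    moreover have "u \<bullet> u > 0"
      using that by simp
    ultimately show ?thesis
      using e by (simp add: add_nonneg_pos)
  qed
  have "transpose A *v (A *v e) = B *v (transpose A *v w)"
    unfolding B Dw[symmetric] D C_def
    by (simp only: matrix_vector_right_distrib matrix_vector_mul_assoc matrix_vector_mult_scaleR
        matrix_mul_assoc)
  \<comment> \<open>Push-through identity \<open>(A\<^sup>T A + \<epsilon> I)\<^sup>-\<^sup>1 A\<^sup>T = A\<^sup>T (A A\<^sup>T + \<epsilon> I)\<^sup>-\<^sup>1\<close>: only on \<open>\<real>\<^sup>m\<close> is \<open>\<sigma>\<^sub>m\<^sup>2\<close> a lower bound.\<close>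
  then have "matrix_inv B *v (transpose A *v (A *v e)) = transpose A *v w"
    using matrix_inv_mult_vector(1)[OF Bpos] by simp
  then have "norm (transpose A *v (A *v e) - l *\<^sub>R (matrix_inv B *v (transpose A *v (A *v e))))
      = norm (transpose A *v (D *v w - l *\<^sub>R w))"
    by (simp only: Dw matrix_vector_mult_diff_distrib matrix_vector_mult_scaleR)
  also have "\<dots> \<le> sigma_max A * norm (D *v w - l *\<^sub>R w)"
    by (rule norm_transpose_matrix_vector_le)
  also have "\<dots> \<le> sigma_max A * ((1 - l / (\<epsilon> + (sigma_max A)\<^sup>2)) * norm (D *v w))"
    using sigma_min_nonneg[of A] sigma_min_le_sigma_max[of A] l low up symD
    by (intro mult_left_mono norm_resolvent_contraction[where a = "\<epsilon> + (sigma_min A)\<^sup>2"])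
      (auto intro: power_mono)
  also have "\<dots> \<le> sigma_max A * ((1 - l / (\<epsilon> + (sigma_max A)\<^sup>2)) * (sigma_max A * norm e))"
  proof -
    \<comment> \<open>The contraction factor must be nonnegative for the bound on
      \<open>A *v e\<close> to be multiplied by it.\<close>
    have "(sigma_min A)\<^sup>2 \<le> (sigma_max A)\<^sup>2"
      using sigma_min_nonneg[of A] sigma_min_le_sigma_max[of A] by (simp add: power_mono)
    then have "l / (\<epsilon> + (sigma_max A)\<^sup>2) \<le> 1"
      using l by simp
    then show ?thesis
      unfolding Dw using sigma_min_nonneg[of A] sigma_min_le_sigma_max[of A]
      by (intro mult_left_mono norm_matrix_vector_le) auto
  qed
  finally show ?thesis
    by (simp add: B_def power2_eq_square mult_ac)
qed

section \<open>Coordinate restriction and the restricted isometry constant\<close>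

text \<open>Zero padding on the full index type, matching \<open>column_submatrix\<close> and
  \<open>identity_on\<close>.\<close>

definition restrict_vec :: "'n set \<Rightarrow> real ^ 'n \<Rightarrow> real ^ 'n" where
  "restrict_vec T u = (\<chi> i. if i \<in> T then u $ i else 0)"

lemma norm_square_vec: "(norm (u :: real ^ 'n))\<^sup>2 = (\<Sum>i\<in>UNIV. (u $ i)\<^sup>2)"
  by (simp add: power2_norm_eq_inner inner_vec_def flip: power2_eq_square)

lemma norm_square_restrict_vec: "(norm (restrict_vec T u))\<^sup>2 = (\<Sum>i\<in>T. (u $ i)\<^sup>2)"
  unfolding norm_square_vec restrict_vec_def
  by (rule sum.mono_neutral_cong_right) auto

lemma norm_restrict_vec_mono: "S \<subseteq> T \<Longrightarrow> norm (restrict_vec S u) \<le> norm (restrict_vec T u)"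
  by (rule power2_le_imp_le) (auto simp: norm_square_restrict_vec intro!: sum_mono2)

lemma norm_restrict_vec_le: "norm (restrict_vec T u) \<le> norm u"
proof -
  have "restrict_vec UNIV u = u"
    by (simp add: restrict_vec_def)
  then show ?thesis
    using norm_restrict_vec_mono[of T UNIV u] by simp
qed

lemma restrict_vec_add: "restrict_vec T (u + v) = restrict_vec T u + restrict_vec T v"
  by (simp add: restrict_vec_def vec_eq_iff)

text \<open>For \<open>e\<close> supported in \<open>T\<close>, the padded matrix belonging to
  \<open>T\<close> in the definition of \<open>RIC\<close> maps \<open>e\<close> to the negative of
  the restricted residual.\<close>

lemma norm_restrict_residual_le_RIC:
  fixes A :: "real ^ 'n ^ 'm"
  assumes T: "card T \<le> q" and supp: "{i. e $ i \<noteq> 0} \<subseteq> T"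
  shows "norm (restrict_vec T (e - transpose A *v (A *v e))) \<le> RIC q A * norm e"
proof -
  define M where "M = transpose (column_submatrix A T) ** column_submatrix A T - identity_on T"
  have "spectral_norm M \<le> RIC q A"
    unfolding RIC_def M_def using T by (intro Max_ge) auto
  moreover have "norm (M *v e) \<le> spectral_norm M * norm e"
    unfolding spectral_norm_def by (rule onorm[OF matrix_vector_mul_bounded_linear])
  moreover have "M *v e = - restrict_vec T (e - transpose A *v (A *v e))"
  proof -
    have Ae: "column_submatrix A T *v e = A *v e"
      using supp by (auto simp: vec_eq_iff matrix_vector_mult_def column_submatrix_def intro!: sum.cong)
    have tr: "transpose (column_submatrix A T) *v v = restrict_vec T (transpose A *v v)" for v
      by (auto simp: vec_eq_iff matrix_vector_mult_def transpose_def column_submatrix_def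
          restrict_vec_def simp del: transpose_matrix_vector)
    have "(identity_on T *v e) $ i = (\<Sum>j\<in>UNIV. if j = i then (if i \<in> T then e $ i else 0) else 0)" for i
      unfolding matrix_vector_mult_def identity_on_def vec_lambda_beta by (rule sum.cong) auto
    then have id: "identity_on T *v e = restrict_vec T e"
      by (simp add: vec_eq_iff restrict_vec_def)
    show ?thesis
      unfolding M_def matrix_vector_mult_diff_rdistrib matrix_vector_mul_assoc[symmetric] Ae tr id
      by (simp add: vec_eq_iff restrict_vec_def)
  qed
  ultimately show ?thesis
    using mult_right_mono[of "spectral_norm M" "RIC q A" "norm e"] by simp
qed

text \<open>Tests the constant on a coordinate vector: the diagonal entry of the residual operator
  is 1 minus the squared norm of a column, and a column has norm at most \<open>sigma_max A\<close>.
  This serves to show that the step length is positive.\<close>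

lemma one_minus_sigma_max_le_RIC:
  fixes A :: "real ^ 'n ^ 'm"
  assumes "q \<ge> 1"
  shows "1 - (sigma_max A)\<^sup>2 \<le> RIC q A"
proof -
  obtain i :: 'n where True
    by simp
  define e :: "real ^ 'n" where "e = axis i 1"
  have ne: "norm e = 1"
    by (simp add: e_def)
  define r where "r = e - transpose A *v (A *v e)"
  have "r $ i = r \<bullet> e"
    by (simp add: e_def inner_axis)
  also have "\<dots> = (norm e)\<^sup>2 - (norm (A *v e))\<^sup>2"
    unfolding r_def inner_diff_left matrix_vector_inner_transpose power2_norm_eq_inner by simp
  also have "\<dots> \<ge> 1 - (sigma_max A)\<^sup>2"
    using power_mono[OF norm_matrix_vector_le[of A e], of 2] ne by simp
  finally have "1 - (sigma_max A)\<^sup>2 \<le> restrict_vec {i} r $ i"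
    by (simp add: restrict_vec_def)
  also have "\<dots> \<le> norm (restrict_vec {i} r)"
    using component_le_norm_cart[of "restrict_vec {i} r" i] by simp
  also have "\<dots> \<le> RIC q A"
    using norm_restrict_residual_le_RIC[of "{i}" q e A] assms ne
    by (auto simp: r_def e_def axis_def)
  finally show ?thesis .
qed

section \<open>Error of hard thresholding\<close>

text \<open>Support indices of \<open>x\<close> that were dropped (\<open>P\<close>) inject into
  retained indices outside the support (\<open>Q\<close>), where \<open>u\<close> is at least as
  large and coincides with \<open>u - x\<close>. Hence the error on \<open>P\<close> is controlled
  by \<open>u - x\<close> on \<open>S \<union> X\<close>.\<close>

lemma hard_thresholding_error:
  fixes u w x :: "real ^ 'n"
  assumes ht: "hard_thresholding k u w" and sp: "sparse_vec k x"
  obtains S where "card S \<le> k" "{i. w $ i \<noteq> 0} \<subseteq> S"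
    "norm (w - x) \<le> sqrt 3 * norm (restrict_vec (S \<union> {i. x $ i \<noteq> 0}) (u - x))"
proof -
  obtain S where cS: "card S = min k CARD('n)"
    and big: "\<And>i j. i \<in> S \<Longrightarrow> j \<notin> S \<Longrightarrow> \<bar>u $ j\<bar> \<le> \<bar>u $ i\<bar>"
    and w: "w = (\<chi> i. if i \<in> S then u $ i else 0)"
    using ht unfolding hard_thresholding_def by blast
  define X where "X = {i. x $ i \<noteq> 0}"
  define P Q where "P = X - S" and "Q = S - X"
  define d where "d = (\<lambda>i. ((u - x) $ i)\<^sup>2)"
  \<comment> \<open>The dimension bound on \<open>card X\<close> covers the case where
    \<open>k\<close> exceeds the dimension.\<close>
  have "card X \<le> card S"
    using sp card_mono[of UNIV X] by (simp add: cS sparse_vec_def X_def)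
  then have "card P \<le> card Q"
    using card_Diff_subset_Int[of X S] card_Diff_subset_Int[of S X]
    by (simp add: P_def Q_def Int_commute)
  then obtain f where f: "f ` P \<subseteq> Q" "inj_on f P"
    using card_le_inj[of P Q] by auto
  have "(\<Sum>i\<in>P. (u $ i)\<^sup>2) \<le> (\<Sum>i\<in>P. (u $ f i)\<^sup>2)"
  proof (rule sum_mono)
    fix i assume "i \<in> P"
    then have "\<bar>u $ i\<bar> \<le> \<bar>u $ f i\<bar>"
      using f(1) by (intro big) (auto simp: P_def Q_def)
    then show "(u $ i)\<^sup>2 \<le> (u $ f i)\<^sup>2"
      by (simp add: abs_le_square_iff)
  qed
  also have "\<dots> = (\<Sum>j\<in>f ` P. (u $ j)\<^sup>2)"
    using f(2) by (simp add: sum.reindex)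
  also have "\<dots> \<le> (\<Sum>j\<in>Q. (u $ j)\<^sup>2)"
    using f(1) by (intro sum_mono2) auto
  also have "\<dots> = sum d Q"
    by (rule sum.cong) (auto simp: Q_def X_def d_def)
  finally have PQ: "(\<Sum>i\<in>P. (u $ i)\<^sup>2) \<le> sum d Q" .
  have "(\<Sum>i\<in>P. (x $ i)\<^sup>2) \<le> (\<Sum>i\<in>P. 2 * d i + 2 * (u $ i)\<^sup>2)"
  proof (rule sum_mono)
    fix i
    \<comment> \<open>This square is exactly the gap between the two sides of the claim.\<close>
    have "0 \<le> (2 * u $ i - x $ i)\<^sup>2"
      by simp
    then show "(x $ i)\<^sup>2 \<le> 2 * d i + 2 * (u $ i)\<^sup>2"
      by (simp add: d_def power2_eq_square algebra_simps)
  qed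
  also have "\<dots> = 2 * sum d P + 2 * (\<Sum>i\<in>P. (u $ i)\<^sup>2)"
    by (simp add: sum.distrib sum_distrib_left)
  also have "\<dots> \<le> 2 * sum d P + 2 * sum d S"
  proof -
    have "sum d Q \<le> sum d S"
      by (rule sum_mono2) (auto simp: Q_def d_def)
    then show ?thesis
      using PQ by simp
  qed
  finally have xP: "(\<Sum>i\<in>P. (x $ i)\<^sup>2) \<le> 2 * sum d P + 2 * sum d S" .
  have "(norm (w - x))\<^sup>2 = (\<Sum>i\<in>S \<union> P. ((w - x) $ i)\<^sup>2)"
    unfolding norm_square_vec by (rule sum.mono_neutral_right) (auto simp: w P_def X_def)
  also have "\<dots> = (\<Sum>i\<in>S. ((w - x) $ i)\<^sup>2) + (\<Sum>i\<in>P. ((w - x) $ i)\<^sup>2)"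
    by (rule sum.union_disjoint) (auto simp: P_def)
  also have "\<dots> = sum d S + (\<Sum>i\<in>P. (x $ i)\<^sup>2)"
    by (intro arg_cong2[where f = "(+)"] sum.cong) (auto simp: w P_def d_def)
  \<comment> \<open>The constant 3 arises on \<open>S\<close>, as 1 from the retained entries plus 2
    from the dropped ones; on \<open>P\<close> the weight is only 2.\<close>
  also have "\<dots> \<le> 3 * (sum d S + sum d P)"
    using xP sum_nonneg[of P d] by (simp add: d_def)
  also have "sum d S + sum d P = sum d (S \<union> P)"
    by (rule sum.union_disjoint[symmetric]) (auto simp: P_def)
  also have "S \<union> P = S \<union> X"
    by (auto simp: P_def)
  also have "3 * sum d (S \<union> X) = (sqrt 3 * norm (restrict_vec (S \<union> X) (u - x)))\<^sup>2"
    by (simp add: power_mult_distrib norm_square_restrict_vec d_def)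
  finally have "norm (w - x) \<le> sqrt 3 * norm (restrict_vec (S \<union> X) (u - x))"
    by (rule power2_le_imp_le) simp
  moreover have "card S \<le> k"
    by (simp add: cS)
  moreover have "{i. w $ i \<noteq> 0} \<subseteq> S"
    by (auto simp: w)
  ultimately show ?thesis
    using that by (simp add: X_def)
qed

lemma hard_thresholding_sparse:
  assumes "hard_thresholding k u w"
  shows "sparse_vec k w"
proof -
  \<comment> \<open>Comparison with the vector 0 gives access to the retained set.\<close>
  obtain S where "card S \<le> k" "{i. w $ i \<noteq> 0} \<subseteq> S"
    using hard_thresholding_error[OF assms, of 0] by (auto simp: sparse_vec_def)
  then show ?thesis
    unfolding sparse_vec_def by (meson card_mono finite order_trans)
qed

section \<open>Contraction of the iteration and convergence\<close>

lemma NSIHT_step_error: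
  fixes A :: "real ^ 'n ^ 'm"
  assumes e: "\<epsilon> > 0" and l: "0 < l" "l \<le> \<epsilon> + (sigma_min A)\<^sup>2"
    and x: "sparse_vec k x" and z: "sparse_vec k z"
    and ht: "hard_thresholding k (z + l *\<^sub>R (matrix_inv (transpose A ** A + \<epsilon> *\<^sub>R mat 1) *v
                          (transpose A *v (A *v x - A *v z)))) w"
  shows "norm (w - x) \<le> sqrt 3 * (RIC (3 * k) A
    + (sigma_max A)\<^sup>2 * (1 - l / (\<epsilon> + (sigma_max A)\<^sup>2))) * norm (z - x)"
proof -
  define d where "d = x - z"
  define g where "g = transpose A *v (A *v d)"
  define n where "n = l *\<^sub>R (matrix_inv (transpose A ** A + \<epsilon> *\<^sub>R mat 1) *v g)"
  have ht: "hard_thresholding k (z + n) w"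
    using ht by (simp add: n_def g_def d_def matrix_vector_mult_diff_distrib)
  \<comment> \<open>\<open>z + n - x = - (I - A\<^sup>T A) d - (A\<^sup>T A d - n)\<close>\<close>
  obtain S where S: "card S \<le> k"
    and err: "norm (w - x) \<le> sqrt 3 * norm (restrict_vec (S \<union> {i. x $ i \<noteq> 0}) (z + n - x))"
    using hard_thresholding_error[OF ht x] by blast
  \<comment> \<open>The \<open>RIC\<close> estimate needs one set containing both the observed
    coordinates and the support of \<open>d\<close>.\<close>
  define T where "T = S \<union> {i. x $ i \<noteq> 0} \<union> {i. z $ i \<noteq> 0}"
  have "card T \<le> card S + card {i. x $ i \<noteq> 0} + card {i. z $ i \<noteq> 0}"
    unfolding T_def by (meson add_le_mono1 card_Un_le order_trans)
  then have T: "card T \<le> 3 * k"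
    using S x z by (simp add: sparse_vec_def)
  have supp: "{i. d $ i \<noteq> 0} \<subseteq> T"
    by (auto simp: d_def T_def)
  have "norm (restrict_vec (S \<union> {i. x $ i \<noteq> 0}) (z + n - x)) \<le> norm (restrict_vec T (z + n - x))"
    by (rule norm_restrict_vec_mono) (auto simp: T_def)
  also have "restrict_vec T (z + n - x) = - restrict_vec T ((d - g) + (g - n))"
    by (simp add: restrict_vec_def vec_eq_iff d_def)
  also have "norm \<dots> \<le> norm (restrict_vec T (d - g)) + norm (restrict_vec T (g - n))"
    unfolding restrict_vec_add norm_minus_cancel by (rule norm_triangle_ineq)
  also have "norm (restrict_vec T (g - n)) \<le> norm (g - n)"
    by (rule norm_restrict_vec_le)
  also have "\<dots> \<le> (sigma_max A)\<^sup>2 * (1 - l / (\<epsilon> + (sigma_max A)\<^sup>2)) * norm d"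
    unfolding n_def g_def by (rule norm_gradient_minus_newton_step_le[OF e l])
  also have "norm (restrict_vec T (d - g)) \<le> RIC (3 * k) A * norm d"
    unfolding g_def by (rule norm_restrict_residual_le_RIC[OF T supp])
  finally have "norm (restrict_vec (S \<union> {i. x $ i \<noteq> 0}) (z + n - x))
      \<le> (RIC (3 * k) A + (sigma_max A)\<^sup>2 * (1 - l / (\<epsilon> + (sigma_max A)\<^sup>2))) * norm (z - x)"
    by (simp add: d_def norm_minus_commute algebra_simps)
  from mult_left_mono[OF this, of "sqrt 3"] show ?thesis
    unfolding mult.assoc by (intro order_trans[OF err]) simp
qed

lemma LIMSEQ_contraction:
  fixes X :: "nat \<Rightarrow> 'a::real_normed_vector"
  assumes step: "\<And>p. norm (X (Suc p) - x) \<le> c * norm (X p - x)" and c: "c < 1"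
  shows "X \<longlonglongrightarrow> x"
proof -
  \<comment> \<open>The sign of \<open>c\<close> is not known; clipping at 0 allows multiplying
    inequalities by it.\<close>
  define c' where "c' = max c 0"
  have c': "0 \<le> c'" "c' < 1"
    using c by (auto simp: c'_def)
  have bound: "norm (X p - x) \<le> c' ^ p * norm (X 0 - x)" for p
  proof (induction p)
    case (Suc p)
    have "norm (X (Suc p) - x) \<le> c' * norm (X p - x)"
      using step[of p] mult_right_mono[of c c' "norm (X p - x)"] by (simp add: c'_def)
    also have "\<dots> \<le> c' * (c' ^ p * norm (X 0 - x))"
      using Suc c' by (intro mult_left_mono)
    finally show ?case
      by (simp add: mult.assoc)
  qed simp
  have "(\<lambda>p. c' ^ p * norm (X 0 - x)) \<longlonglongrightarrow> 0"
    using c' by (intro tendsto_mult_left_zero LIMSEQ_realpow_zero)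
  then have "(\<lambda>p. X p - x) \<longlonglongrightarrow> 0"
    by (rule Lim_null_comparison[OF always_eventually, rotated]) (simp add: bound)
  then show ?thesis
    using LIM_zero_cancel by blast
qed

theorem mainTheorem1:
  fixes A :: "real ^ 'n ^ 'm" and k :: nat and \<epsilon> l :: real
    and x :: "real ^ 'n" and X :: "nat \<Rightarrow> real ^ 'n"
  assumes "CARD('m) < CARD('n)"
    and "k \<ge> 1"
    and "RIC (3 * k) A < 1 / sqrt 3"
    and "\<epsilon> > max ((sigma_max A)\<^sup>2)
                  ((((sigma_max A)\<^sup>2 - (sigma_min A)\<^sup>2) / (1 / sqrt 3 - RIC (3 * k) A) - 1)
                    * (sigma_max A)\<^sup>2)"
    and "\<epsilon> + (sigma_max A)\<^sup>2
           - (1 / sqrt 3 - RIC (3 * k) A) * ((\<epsilon> + (sigma_max A)\<^sup>2) / (sigma_max A)\<^sup>2) < l"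
    and "l \<le> \<epsilon> + (sigma_min A)\<^sup>2"
    and "sparse_vec k x"
    and "NSIHT_sequence A (A *v x) k \<epsilon> l X"
  shows "X \<longlonglongrightarrow> x"
proof -
  let ?s = "(sigma_max A)\<^sup>2" and ?c = "1 / sqrt 3 - RIC (3 * k) A"
  have ord: "(sigma_min A)\<^sup>2 \<le> ?s"
    using sigma_min_nonneg[of A] sigma_min_le_sigma_max[of A] by (simp add: power_mono)
  have es: "\<epsilon> > ?s"
    using assms(4) by simp
  have e: "\<epsilon> > 0"
    using es zero_le_power2[of "sigma_max A"] by linarith
  \<comment> \<open>If \<open>sigma_max A = 0\<close>, division by zero yields 0, so the lower bound
    on \<open>l\<close> reads \<open>\<epsilon> < l\<close> while the upper bound gives
    \<open>l \<le> \<epsilon>\<close>.\<close>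
  have s: "?s > 0"
  proof (rule ccontr)
    assume "\<not> ?s > 0"
    then have "sigma_max A = 0"
      by simp
    then show False
      using assms(5,6) ord by simp
  qed
  have b: "\<epsilon> + ?s > 0"
    using e s by linarith
  have "1 / sqrt 3 < (1::real)"
    by simp
  moreover have "1 - ?s \<le> RIC (3 * k) A"
    using assms(2) by (intro one_minus_sigma_max_le_RIC) simp
  ultimately have "?c < ?s"
    by linarith
  \<comment> \<open>The amount subtracted in the lower bound on \<open>l\<close> is thus at most
    \<open>\<epsilon> + ?s\<close>, so that bound is nonnegative.\<close>
  then have "?c * (\<epsilon> + ?s) \<le> ?s * (\<epsilon> + ?s)"
    using b by (intro mult_right_mono) auto
  then have "?c * ((\<epsilon> + ?s) / ?s) \<le> \<epsilon> + ?s"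
    using s by (simp add: divide_le_eq mult.commute)
  then have l: "0 < l"
    using assms(5) by linarith
  define r where "r = RIC (3 * k) A + ?s * (1 - l / (\<epsilon> + ?s))"
  have "?s * (1 - l / (\<epsilon> + ?s)) = ?s * (\<epsilon> + ?s - l) / (\<epsilon> + ?s)"
    using b by (simp add: field_simps)
  also have "\<dots> < ?s * (?c * ((\<epsilon> + ?s) / ?s)) / (\<epsilon> + ?s)"
    using assms(5) s b by (intro divide_strict_right_mono mult_strict_left_mono) linarith+
  also have "\<dots> = ?c"
    using s b by simp
  finally have "r < 1 / sqrt 3"
    by (simp add: r_def)
  then have r: "sqrt 3 * r < 1"
    by (simp add: field_simps)
  have ht: "hard_thresholding k (X p + l *\<^sub>R (matrix_inv (transpose A ** A + \<epsilon> *\<^sub>R mat 1) *v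
                          (transpose A *v (A *v x - A *v X p)))) (X (Suc p))" for p
    using assms(8) unfolding NSIHT_sequence_def by blast
  \<comment> \<open>The start \<open>X 0\<close> is arbitrary and may fail to be sparse; from index
    1 on every iterate is an output of thresholding, so the contraction is stated for the shifted
    sequence.\<close>
  have "norm (X (Suc (Suc p)) - x) \<le> sqrt 3 * r * norm (X (Suc p) - x)" for p
    unfolding r_def
    by (rule NSIHT_step_error[OF e l assms(6,7) hard_thresholding_sparse[OF ht] ht])
  then have "(\<lambda>p. X (Suc p)) \<longlonglongrightarrow> x"
    by (rule LIMSEQ_contraction[OF _ r])
  then show ?thesis
    by (rule LIMSEQ_imp_Suc)
qed

end
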